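(* Let $p$ be a prime with $p\equiv1\pmod4$, and write $p=c^2+d^2$ with $c,d\in\mathbb Z$ and $2\mid d$. Let $a\in\mathbb Z$ with $p\nmid(1+16a^2)(1-16a^2)$. Then $$2\sum_{k=0}^{[p/8]}\binom{8k}{4k}a^{4k}\equiv\begin{cases}\big(\frac{1-4a}p\big)+\big(\frac{c-4ad}{16a^2+1}\big)\pmod p&\text{if }\big(\frac{1-16a^2}p\big)=\big(\frac{1+16a^2}p\big)=1,\\ \big(\frac{1-4a}p\big)\pmod p&\text{if }\big(\frac{1-16a^2}p\big)=-\big(\frac{1+16a^2}p\big)=1,\\ \big(\frac{c-4ad}{16a^2+1}\big)\pmod p&\text{if }\big(\frac{1-16a^2}p\big)=-\big(\frac{1+16a^2}p\big)=-1,\\ 0\pmod p&\text{if }\big(\frac{1-16a^2}p\big)=\big(\frac{1+16a^2}p\big)=-1.\end{cases}$$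
   Context: $[x]$ is the greatest integer not exceeding $x$; $\big(\frac{\cdot}{p}\big)$ is the Legendre symbol and $\big(\frac{x}{16a^2+1}\big)$ the Jacobi symbol. *)

theory Defs
  imports "HOL-Number_Theory.Number_Theory"
begin

(* Intended for odd n > 0; for n = 1 the product is empty, so the symbol is 1. *)
definition Jacobi :: "int \<Rightarrow> int \<Rightarrow> int"
  where "Jacobi x n = (\<Prod>q\<in>#prime_factorization n. Legendre x q)"

end

theory Submission
  imports Defs
begin

text \<open>
  Put \<open>n = (p - 1) / 2\<close>. Modulo \<open>p\<close> one has \<open>binom(2j, j) = (-4)^j binom(n, j)\<close> for \<open>j \<le> n\<close>,
  so the sum is congruent to the part of \<open>(1 + 4a)^n\<close> with exponents divisible by 4. With
  \<open>i = -d/c\<close>, a square root of \<open>-1\<close> modulo \<open>p\<close>, this part is the mean of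
  \<open>(1 + 4a)^n, (1 - 4a)^n, (1 + 4ai)^n, (1 - 4ai)^n\<close>, and by Euler's criterion these powers are
  Legendre symbols. Finally \<open>c (1 + 4ai) = u\<close> modulo \<open>p\<close> with \<open>u = c - 4ad\<close>, and
  \<open>p = d^2 (16a^2 + 1)\<close> modulo \<open>u\<close>. All prime factors of \<open>p\<close> and of \<open>16a^2 + 1\<close> are 1 modulo 4,
  so reciprocity for the Jacobi symbol turns this into \<open>(u/p) = (u/(16a^2 + 1))\<close>, and likewise
  \<open>(c/p) = (p/c) = (d^2/c) = 1\<close>.
\<close>

section \<open>Elementary properties of the Legendre symbol\<close>

lemma Legendre_cong: "[a = b] (mod p) \<Longrightarrow> Legendre a p = Legendre b p"
  by (simp add: Legendre_def QuadRes_def cong_def)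

lemma Legendre_cases: "Legendre a p = 0 \<or> Legendre a p = 1 \<or> Legendre a p = -1"
  by (simp add: Legendre_def)

lemma Legendre_eq_0_iff: "Legendre a p = 0 \<longleftrightarrow> p dvd a"
  by (simp add: Legendre_def cong_0_iff)

lemma Legendre_1: "prime p \<Longrightarrow> Legendre 1 p = 1"
  unfolding Legendre_def QuadRes_def
  by (metis Legendre_def Legendre_eq_0_iff cong_refl not_prime_unit one_power2)

lemma Legendre_square:
  assumes "prime p" "\<not> p dvd b"
  shows "Legendre (b\<^sup>2) p = 1"
proof -
  have "QuadRes p (b\<^sup>2)" unfolding QuadRes_def using cong_refl by blast
  then show ?thesis using assms by (simp add: Legendre_def cong_0_iff prime_dvd_power_iff)
qed

text \<open>Two numbers of absolute value at most 1 differ by at most 2, which is less than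
  \<open>p\<close>. This turns congruences obtained from Euler's criterion into equalities of
  Legendre symbols.\<close>

lemma cong_imp_eq_of_abs_le_1:
  fixes x y p :: int
  assumes "[x = y] (mod p)" "2 < p" "\<bar>x\<bar> \<le> 1" "\<bar>y\<bar> \<le> 1"
  shows "x = y"
proof -
  have "p dvd x - y" using assms(1) by (simp add: cong_iff_dvd_diff)
  moreover have "\<bar>x - y\<bar> < p" using assms by linarith
  ultimately show ?thesis using dvd_imp_le_int[of "x - y" p] by fastforce
qed

lemma euler_criterion_int:
  fixes p a :: int
  assumes "prime p" "2 < p"
  shows "[Legendre a p = a ^ ((nat p - 1) div 2)] (mod p)"
  using euler_criterion[of "nat p" a] assms by simp

lemma abs_Legendre_le_1: "\<bar>Legendre a p\<bar> \<le> 1"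
  using Legendre_cases[of a p] by auto

lemma Legendre_mult:
  fixes p :: int
  assumes "prime p" "2 < p"
  shows "Legendre (a * b) p = Legendre a p * Legendre b p"
proof (rule cong_imp_eq_of_abs_le_1)
  show "[Legendre (a * b) p = Legendre a p * Legendre b p] (mod p)"
    using euler_criterion_int[OF assms, of "a * b"]
      cong_mult[OF euler_criterion_int[OF assms, of a] euler_criterion_int[OF assms, of b]]
    by (metis cong_sym cong_trans power_mult_distrib)
  show "\<bar>Legendre a p * Legendre b p\<bar> \<le> 1"
    using Legendre_cases[of a p] Legendre_cases[of b p] by auto
qed (use assms abs_Legendre_le_1 in auto)

section \<open>Reciprocity when one side has only prime factors 1 modulo 4\<close>

lemma Legendre_minus_1:
  fixes p :: int
  assumes "prime p" "[p = 1] (mod 4)"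
  shows "Legendre (-1) p = 1"
proof (rule cong_imp_eq_of_abs_le_1)
  obtain k where k: "p = 1 + 4 * k"
    using assms(2) by (metis cong_iff_lin cong_sym)
  have "1 < p" using assms(1) by (rule prime_gt_1_int)
  then show p2: "2 < p" using k by presburger
  then have "nat p = 1 + 4 * nat k" using k by simp
  then have "even ((nat p - 1) div 2)" by simp
  then show "[Legendre (-1) p = 1] (mod p)"
    using euler_criterion_int[OF assms(1) p2, of "-1"] by simp
qed (use abs_Legendre_le_1 in auto)

text \<open>Since (r - 1) / 2 is even, the sign in quadratic reciprocity is +1, so for distinct
  primes the two symbols have product 1 and hence agree.\<close>

lemma Legendre_reciprocity_1_mod_4:
  fixes q r :: int
  assumes "prime q" "odd q" "prime r" "[r = 1] (mod 4)"
  shows "Legendre q r = Legendre r q"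
proof (cases "q = r")
  case False
  obtain k where k: "r = 1 + 4 * k"
    using assms(4) by (metis cong_iff_lin cong_sym)
  have gt: "1 < q" "1 < r" using assms by (auto intro: prime_gt_1_int)
  then have "2 < q" "2 < r" using assms(2) k by presburger+
  moreover have "even (nat ((q - 1) div 2 * ((r - 1) div 2)))"
    using gt k by (simp add: even_nat_iff)
  ultimately have "Legendre q r * Legendre r q = 1"
    using Quadratic_Reciprocity_int[of q r] assms False gt by (simp add: mult.commute)
  then show ?thesis using Legendre_cases[of q r] Legendre_cases[of r q] by auto
qed simp

lemma Legendre_prod_mset:
  fixes p :: int
  assumes "prime p" "2 < p"
  shows "Legendre (\<Prod>x\<in>#A. f x) p = (\<Prod>x\<in>#A. Legendre (f x) p)"
  by (induction A) (use assms in \<open>simp_all add: Legendre_mult Legendre_1\<close>)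

text \<open>As -1 is a square modulo \<open>p\<close>, the sign of the argument is irrelevant. This
  matters because \<open>prime_factorization\<close> of a negative integer only recovers its
  absolute value.\<close>

lemma Legendre_abs:
  fixes p :: int
  assumes "prime p" "[p = 1] (mod 4)" "2 < p"
  shows "Legendre \<bar>a\<bar> p = Legendre a p"
  using Legendre_mult[OF assms(1,3), of "-1" a] Legendre_minus_1[OF assms(1,2)]
  by (simp add: abs_if)

lemma Legendre_eq_prod_prime_factorization:
  fixes p a :: int
  assumes "prime p" "[p = 1] (mod 4)" "2 < p" "a \<noteq> 0"
  shows "Legendre a p = (\<Prod>q\<in>#prime_factorization a. Legendre q p)"
proof -
  have "(\<Prod>q\<in>#prime_factorization a. q) = \<bar>a\<bar>"
    using prod_mset_prime_factorization[OF assms(4)] by simp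
  then show ?thesis
    using Legendre_prod_mset[OF assms(1,3), of "\<lambda>x. x" "prime_factorization a"]
      Legendre_abs[OF assms(1-3)] by simp
qed

lemma prod_mset_cong_on:
  "(\<And>x. x \<in># A \<Longrightarrow> f x = g x) \<Longrightarrow> (\<Prod>x\<in>#A. f x) = (\<Prod>x\<in>#A. g x)"
  by (rule arg_cong[where f = prod_mset]) (rule image_mset_cong)

lemma odd_prime_factor:
  fixes u q :: int
  assumes "odd u" "q \<in># prime_factorization u"
  shows "prime q" "odd q" "2 < q" "q dvd u"
proof -
  show q: "prime q" "q dvd u" using assms(2) by (auto simp: in_prime_factors_iff)
  then show "odd q" using assms(1) dvd_trans by blast
  then show "2 < q" using prime_gt_1_int[OF q(1)] by presburger
qed

text \<open>Both symbols expand to double products of Legendre symbols over the prime factors of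
  \<open>m\<close> and \<open>u\<close>, and prime reciprocity flips each factor. A negative
  \<open>u\<close> is allowed: \<open>Jacobi m u\<close> sees only the primes dividing
  \<open>u\<close>, and -1 is a square modulo every prime factor of \<open>m\<close>.\<close>

lemma Jacobi_reciprocity:
  fixes m u :: int
  assumes "odd u" "0 < m"
    and m1: "\<And>r. prime r \<Longrightarrow> r dvd m \<Longrightarrow> [r = 1] (mod 4)"
  shows "Jacobi u m = Jacobi m u"
proof -
  have r: "prime r" "[r = 1] (mod 4)" "2 < r" if "r \<in># prime_factorization m" for r
  proof -
    show *: "prime r" "[r = 1] (mod 4)" using that m1 by (auto simp: in_prime_factors_iff)
    then show "2 < r" using prime_gt_1_int[OF *(1)] unfolding cong_def by presburger
  qed
  have "Jacobi u m = (\<Prod>r\<in>#prime_factorization m. \<Prod>q\<in>#prime_factorization u. Legendre q r)"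
    unfolding Jacobi_def
    by (rule prod_mset_cong_on, rule Legendre_eq_prod_prime_factorization) (use r assms in auto)
  also have "\<dots> = (\<Prod>r\<in>#prime_factorization m. \<Prod>q\<in>#prime_factorization u. Legendre r q)"
    by (intro prod_mset_cong_on Legendre_reciprocity_1_mod_4)
       (use r odd_prime_factor[OF assms(1)] in auto)
  also have "\<dots> = (\<Prod>q\<in>#prime_factorization u. \<Prod>r\<in>#prime_factorization m. Legendre r q)"
    by (rule prod_mset.swap)
  also have "\<dots> = (\<Prod>q\<in>#prime_factorization u. Legendre (\<Prod>r\<in>#prime_factorization m. r) q)"
    by (intro prod_mset_cong_on Legendre_prod_mset[symmetric])
       (use odd_prime_factor[OF assms(1)] in auto)
  also have "(\<Prod>r\<in>#prime_factorization m. r) = m"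
    using prod_mset_prime_factorization[of m] assms(2) by simp
  finally show ?thesis by (simp add: Jacobi_def)
qed

lemma Jacobi_prime: "prime p \<Longrightarrow> Jacobi x p = Legendre x p"
  by (simp add: Jacobi_def prime_factorization_prime)

lemma Legendre_eq_Jacobi_swap:
  fixes p u :: int
  assumes "prime p" "[p = 1] (mod 4)" "odd u"
  shows "Legendre u p = Jacobi p u"
proof -
  have "Jacobi u p = Jacobi p u"
  proof (rule Jacobi_reciprocity[OF assms(3)])
    show "0 < p" using assms(1) by (rule prime_gt_0_int)
    show "[r = 1] (mod 4)" if "prime r" "r dvd p" for r
      using primes_dvd_imp_eq[OF that(1) assms(1) that(2)] assms(2) by simp
  qed
  then show ?thesis using Jacobi_prime[OF assms(1)] by simp
qed

section \<open>Symbols attached to a sum of two squares\<close>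

lemma prime_dvd_square_plus_1:
  fixes r x :: int
  assumes "prime r" "odd r" "r dvd x\<^sup>2 + 1"
  shows "[r = 1] (mod 4)"
proof (rule ccontr)
  assume "\<not> [r = 1] (mod 4)"
  then have r3: "r mod 4 = 3" using assms(2) unfolding cong_def by presburger
  have gt: "1 < r" using assms(1) by (rule prime_gt_1_int)
  then have "2 < r" using assms(2) by presburger
  have "[x\<^sup>2 = -1] (mod r)" using assms(3) by (simp add: cong_iff_dvd_diff)
  then have "QuadRes r (-1)" by (auto simp: QuadRes_def)
  moreover have "\<not> r dvd -1" using gt by simp
  ultimately have L: "Legendre (-1) r = 1" by (simp add: Legendre_def cong_0_iff)
  obtain k where "r = 4 * k + 3" using r3 by (metis mult_div_mod_eq)
  moreover from this have "0 \<le> k" using gt by simp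
  \<comment> \<open>The exponent (r - 1) / 2 is odd, so Euler's criterion gives -1 for the symbol of
    -1, against the value 1 just found.\<close>
  ultimately have "nat r - 1 = 2 * (2 * nat k + 1)" by simp
  then have "odd ((nat r - 1) div 2)" by simp
  then have "[1 = -1] (mod r)"
    using euler_criterion_int[OF assms(1) \<open>2 < r\<close>, of "-1"] L by simp
  then have "(1::int) = -1" by (rule cong_imp_eq_of_abs_le_1) (use \<open>2 < r\<close> in auto)
  then show False by simp
qed

text \<open>After reciprocity, \<open>p\<close> is congruent to the square of \<open>d\<close>
  modulo each prime factor of \<open>c\<close>, and coprimality keeps that square nonzero.\<close>

lemma Legendre_sum_two_squares_eq_1:
  fixes p c d :: int
  assumes "prime p" "[p = 1] (mod 4)" "p = c\<^sup>2 + d\<^sup>2" "odd c" "coprime c d"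
  shows "Legendre c p = 1"
proof -
  have "Legendre c p = Jacobi p c"
    by (rule Legendre_eq_Jacobi_swap[OF assms(1,2,4)])
  also have "\<dots> = (\<Prod>q\<in>#prime_factorization c. 1)"
    unfolding Jacobi_def
  proof (rule prod_mset_cong_on)
    fix q assume "q \<in># prime_factorization c"
    then have q: "prime q" "q dvd c" by (auto simp: in_prime_factors_iff)
    then have nd: "\<not> q dvd d" using assms(5) by (meson not_coprimeI not_prime_unit)
    have "[p = d\<^sup>2] (mod q)"
      using q assms(3) by (simp add: cong_iff_dvd_diff power2_eq_square)
    then show "Legendre p q = 1" using Legendre_cong Legendre_square[OF q(1) nd] by metis
  qed
  finally show ?thesis by simp
qed

text \<open>Reciprocity is applied twice, with a change of numerator from \<open>p\<close> to
  \<open>x\<^sup>2 + 1\<close> in between. Evenness of \<open>x\<close> makes both \<open>u\<close>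
  and \<open>x\<^sup>2 + 1\<close> odd. The case of interest is x = 4a.\<close>

lemma Legendre_eq_Jacobi_two_squares:
  fixes p c d x :: int
  assumes "prime p" "[p = 1] (mod 4)" "p = c\<^sup>2 + d\<^sup>2" "odd c" "even x" "coprime c d"
  shows "Legendre (c - x * d) p = Jacobi (c - x * d) (x\<^sup>2 + 1)"
proof -
  define u where "u = c - x * d"
  have "odd u" using assms by (simp add: u_def)
  have "Legendre u p = Jacobi p u"
    by (rule Legendre_eq_Jacobi_swap[OF assms(1,2) \<open>odd u\<close>])
  also have "\<dots> = Jacobi (x\<^sup>2 + 1) u"
    unfolding Jacobi_def
  proof (rule prod_mset_cong_on)
    fix q assume "q \<in># prime_factorization u"
    note q = odd_prime_factor[OF \<open>odd u\<close> this]
    have nd: "\<not> q dvd d"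
    proof
      assume "q dvd d"
      moreover have "c = u + x * d" by (simp add: u_def)
      ultimately have "q dvd c" using q(4) by simp
      then show False using \<open>q dvd d\<close> assms(6) q(1) by (meson not_coprimeI not_prime_unit)
    qed
    \<comment> \<open>The left side is c^2 - (x d)^2, a difference of squares with factor
      \<open>u\<close>.\<close>
    have "p - d\<^sup>2 * (x\<^sup>2 + 1) = u * (c + x * d)"
      unfolding assms(3) u_def by (simp add: algebra_simps power2_eq_square)
    then have "[p = d\<^sup>2 * (x\<^sup>2 + 1)] (mod q)" using q(4) by (simp add: cong_iff_dvd_diff)
    then show "Legendre p q = Legendre (x\<^sup>2 + 1) q"
      using Legendre_cong Legendre_mult[OF q(1,3)] Legendre_square[OF q(1) nd]
      by (metis mult_1)
  qed
  also have "\<dots> = Jacobi u (x\<^sup>2 + 1)"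
  proof (rule Jacobi_reciprocity[symmetric])
    fix r :: int assume r: "prime r" "r dvd x\<^sup>2 + 1"
    have "odd (x\<^sup>2 + 1)" using assms(5) by simp
    then have "odd r" using r(2) dvd_trans by blast
    then show "[r = 1] (mod 4)" using r prime_dvd_square_plus_1 by blast
  qed (use \<open>odd u\<close> in \<open>auto simp: add_nonneg_pos\<close>)
  finally show ?thesis by (simp add: u_def)
qed

section \<open>Central binomial coefficients modulo p\<close>

lemma central_binomial_Suc:
  "Suc j * ((2 * Suc j) choose Suc j) = 2 * (2 * j + 1) * ((2 * j) choose j)"
proof -
  \<comment> \<open>An extra factor \<open>Suc j\<close> is carried along so that absorption can be
    used a second time; it is cancelled at the end.\<close>
  have "Suc j * (Suc j * ((2 * Suc j) choose Suc j)) = Suc j * (2 * Suc j * (Suc (2 * j) choose j))"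
    using Suc_times_binomial[of j "Suc (2 * j)"] by (simp del: binomial_Suc_Suc)
  also have "\<dots> = 2 * Suc j * (Suc j * (Suc (2 * j) choose Suc j))"
    using binomial_symmetric[of j "Suc (2 * j)"] by (simp del: binomial_Suc_Suc)
  also have "\<dots> = Suc j * (2 * (2 * j + 1) * ((2 * j) choose j))"
    unfolding Suc_times_binomial by simp
  finally show ?thesis by (simp only: mult_cancel1) simp
qed

text \<open>Both sides start at 1, and their successive ratios 2(2j + 1)/(j + 1) and -4(n - j)/(j +
  1) agree modulo \<open>p\<close> because 2n is -1. The denominator is invertible since j + 1 \<le>
  n < p.\<close>

lemma central_binomial_cong:
  fixes p :: nat
  assumes "prime p" "p = 2 * n + 1" "j \<le> n"
  shows "[int ((2 * j) choose j) = (-4) ^ j * int (n choose j)] (mod int p)"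
  using assms(3)
proof (induction j)
  case (Suc j)
  have "coprime (Suc j) p"
  proof -
    have "\<not> p dvd Suc j" using Suc.prems assms(2) by (intro nat_dvd_not_less) auto
    then show ?thesis using prime_imp_coprime[OF assms(1)] coprime_commute by blast
  qed
  then have cop: "coprime (int (Suc j)) (int p)" by (simp only: coprime_int_iff)
  have "int (Suc j) * int (n choose Suc j) = int (n - j) * int (n choose j)"
    using binomial_absorption[of j n] binomial_absorb_comp[of n j] by (metis of_nat_mult)
  then have B: "int (Suc j) * int (n choose Suc j) = (int n - int j) * int (n choose j)"
    using Suc.prems by (simp add: of_nat_diff)
  have A: "int (Suc j) * int ((2 * Suc j) choose Suc j) = 2 * (2 * int j + 1) * int ((2 * j) choose j)"
    using arg_cong[OF central_binomial_Suc[of j], of int] by (simp only: of_nat_mult of_nat_add) simp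
  have "[2 * (2 * int j + 1) = (-4) * (int n - int j)] (mod int p)"
  proof -
    have "2 * (2 * int j + 1) - (-4) * (int n - int j) = int p * 2" using assms(2) by simp
    then show ?thesis by (simp only: cong_iff_dvd_diff dvd_triv_left)
  qed
  then have "[2 * (2 * int j + 1) * int ((2 * j) choose j)
      = (-4) * (int n - int j) * ((-4) ^ j * int (n choose j))] (mod int p)"
    using Suc.IH Suc.prems by (intro cong_mult[of "2 * (2 * int j + 1)"]) auto
  also have "(-4) * (int n - int j) * ((-4) ^ j * int (n choose j))
      = int (Suc j) * ((-4) ^ Suc j * int (n choose Suc j))"
  proof -
    have "(-4) * (int n - int j) * ((-4) ^ j * int (n choose j))
        = (-4) ^ Suc j * ((int n - int j) * int (n choose j))"
      by (simp only: power_Suc mult_ac)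
    then show ?thesis unfolding B[symmetric] by (simp only: mult_ac)
  qed
  finally show ?case unfolding A[symmetric] using cop by (simp only: cong_mult_lcancel)
qed simp

text \<open>Orthogonality for the fourth roots of unity 1, -1, \<open>i\<close>, \<open>-i\<close>:
  the sum modulo \<open>m\<close> depends only on \<open>j\<close> modulo 4.\<close>

lemma sum_fourth_roots_of_unity_cong:
  fixes i m :: int
  assumes "[i\<^sup>2 = -1] (mod m)"
  shows "[1 + (-1) ^ j + i ^ j + (-i) ^ j = (if 4 dvd j then 4 else 0)] (mod m)"
proof -
  have "[(i\<^sup>2)\<^sup>2 = (-1)\<^sup>2] (mod m)" by (rule cong_pow[OF assms])
  then have i4: "[i ^ 4 = 1] (mod m)" by simp
  define q where "q = j div 4"
  have "j mod 4 < 4" by simp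
  then consider "j = 4 * q" | "j = 4 * q + 1" | "j = 4 * q + 2" | "j = 4 * q + 3"
    unfolding q_def by linarith
  then show ?thesis
  proof cases
    case 1
    have "[i ^ (4 * q) = 1] (mod m)" using cong_pow[OF i4, of q] by (simp add: power_mult)
    then have "[1 + 1 + i ^ (4 * q) + i ^ (4 * q) = 1 + 1 + 1 + 1] (mod m)"
      by (intro cong_add cong_refl)
    then show ?thesis using 1 by (simp add: power_mult)
  next
    case 3
    have "[i ^ (4 * q) * i\<^sup>2 = 1 * (-1)] (mod m)"
      using cong_pow[OF i4, of q] assms by (intro cong_mult) (simp_all add: power_mult)
    then have "[1 + 1 + i ^ j + i ^ j = 1 + 1 + (-1) + (-1)] (mod m)"
      unfolding 3 power_add by (intro cong_add cong_refl) simp_all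
    moreover have "even j" "\<not> 4 dvd j" using 3 by presburger+
    ultimately show ?thesis by simp
  next
    \<comment> \<open>For odd \<open>j\<close> the four terms cancel in pairs already as
      integers.\<close>
    case 2
    then have "odd j" "\<not> 4 dvd j" by presburger+
    then show ?thesis by simp
  next
    case 4
    then have "odd j" "\<not> 4 dvd j" by presburger+
    then show ?thesis by simp
  qed
qed

text \<open>Expanding the four powers multiplies the coefficient of \<open>x ^ j\<close> by the sum
  of j-th powers of the fourth roots of unity, which removes every exponent not divisible by
  4.\<close>

lemma binomial_quadrisection_cong:
  fixes i m x :: int
  assumes "[i\<^sup>2 = -1] (mod m)"
  shows "[(1 + x) ^ n + (1 - x) ^ n + (1 + x * i) ^ n + (1 - x * i) ^ n
    = 4 * (\<Sum>k\<le>n div 4. int (n choose (4 * k)) * x ^ (4 * k))] (mod m)"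
proof -
  have bin: "(1 + y) ^ n = (\<Sum>j\<le>n. int (n choose j) * y ^ j)" for y :: int
    using binomial_ring[of y 1 n] by (simp add: add.commute)
  have "(1 + x) ^ n + (1 - x) ^ n + (1 + x * i) ^ n + (1 - x * i) ^ n
      = (\<Sum>j\<le>n. int (n choose j) * x ^ j * (1 + (-1) ^ j + i ^ j + (-i) ^ j))"
  proof -
    have "int (n choose j) * x ^ j * (1 + (-1) ^ j + i ^ j + (-i) ^ j)
        = int (n choose j) * x ^ j + int (n choose j) * (x * (-1)) ^ j
          + int (n choose j) * (x * i) ^ j + int (n choose j) * (x * (-i)) ^ j" for j
      unfolding power_mult_distrib by (simp only: distrib_left mult_1_right mult.assoc)
    then show ?thesis
      using bin[of x] bin[of "x * (-1)"] bin[of "x * i"] bin[of "x * (-i)"]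
      by (simp add: sum.distrib)
  qed
  also have "[\<dots> = (\<Sum>j\<le>n. int (n choose j) * x ^ j * (if 4 dvd j then 4 else 0))] (mod m)"
    by (intro cong_sum cong_mult cong_refl sum_fourth_roots_of_unity_cong assms)
  also have "(\<Sum>j\<le>n. int (n choose j) * x ^ j * (if 4 dvd j then 4 else 0))
      = (\<Sum>j\<in>(*) 4 ` {..n div 4}. 4 * (int (n choose j) * x ^ j))"
    by (rule sum.mono_neutral_cong_right) (auto simp: image_iff elim!: dvdE)
  also have "\<dots> = 4 * (\<Sum>k\<le>n div 4. int (n choose (4 * k)) * x ^ (4 * k))"
    by (subst sum.reindex) (auto simp: inj_on_def sum_distrib_left)
  finally show ?thesis .
qed

section \<open>Evaluation of the sum\<close>

theorem theorem2p12:
  fixes p :: nat and a c d :: int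
  assumes "prime p"
    and "[p = 1] (mod 4)"
    and "int p = c ^ 2 + d ^ 2"
    and "2 dvd d"
    and "\<not> int p dvd (1 + 16 * a ^ 2) * (1 - 16 * a ^ 2)"
  defines "S \<equiv> 2 * (\<Sum>k = 0..p div 8. int ((8 * k) choose (4 * k)) * a ^ (4 * k))"
  shows "(Legendre (1 - 16 * a ^ 2) (int p) = 1 \<and> Legendre (1 + 16 * a ^ 2) (int p) = 1 \<longrightarrow>
            [S = Legendre (1 - 4 * a) (int p) + Jacobi (c - 4 * a * d) (16 * a ^ 2 + 1)] (mod int p)) \<and>
         (Legendre (1 - 16 * a ^ 2) (int p) = 1 \<and> - Legendre (1 + 16 * a ^ 2) (int p) = 1 \<longrightarrow>
            [S = Legendre (1 - 4 * a) (int p)] (mod int p)) \<and>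
         (Legendre (1 - 16 * a ^ 2) (int p) = -1 \<and> - Legendre (1 + 16 * a ^ 2) (int p) = -1 \<longrightarrow>
            [S = Jacobi (c - 4 * a * d) (16 * a ^ 2 + 1)] (mod int p)) \<and>
         (Legendre (1 - 16 * a ^ 2) (int p) = -1 \<and> Legendre (1 + 16 * a ^ 2) (int p) = -1 \<longrightarrow>
            [S = 0] (mod int p))"
proof -
  obtain n where n: "p = 2 * n + 1" "even n"
  proof -
    have "p mod 4 = 1" using assms(2) by (simp add: cong_def)
    then have "p = 2 * (p div 2) + 1" "even (p div 2)" by presburger+
    then show ?thesis using that by blast
  qed
  have P: "prime (int p)" using assms(1) by simp
  have p2: "2 < int p" using n prime_gt_1_nat[OF assms(1)] by presburger
  have p4: "[int p = 1] (mod 4)" using assms(2) by (metis cong_int_iff of_nat_1 of_nat_numeral)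
  have np: "(nat (int p) - 1) div 2 = n" using n by simp
  have odd_c: "odd c"
  proof
    assume "even c"
    then have "even (int p)" using assms(3,4) by simp
    then show False using n by simp
  qed
  have cop: "coprime c d"
  proof (rule coprimeI)
    fix g assume "g dvd c" "g dvd d"
    then have "g\<^sup>2 dvd int p" using assms(3) by (simp add: dvd_power_same)
    then obtain h where "int p = g * (g * h)"
      unfolding power2_eq_square by (metis dvdE mult.assoc)
    \<comment> \<open>Irreducibility makes \<open>g\<close> or \<open>g * h\<close> a unit, and
      \<open>g\<close> is a unit in either case.\<close>
    moreover have "irreducible (int p)" using P by (simp add: prime_elem_imp_irreducible)
    ultimately show "is_unit g" using irreducibleD[of "int p" g "g * h"] by (metis is_unit_mult_iff)
  qed
  have cop_cp: "coprime c (int p)"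
  proof (rule coprimeI)
    fix g assume "g dvd c" "g dvd int p"
    then have "g dvd int p - c\<^sup>2" by (simp add: power2_eq_square)
    then have "g dvd d\<^sup>2" using assms(3) by simp
    moreover have "coprime c (d\<^sup>2)" using cop by simp
    ultimately show "is_unit g" using \<open>g dvd c\<close> coprime_common_divisor by blast
  qed
  then obtain e where e: "[c * e = 1] (mod int p)" using cong_solve_coprime_int by blast
  \<comment> \<open>Here \<open>e\<close> inverts \<open>c\<close>, so \<open>i\<close> is -d/c;
    this sign makes c(1 + 4ai) congruent to c - 4ad.\<close>
  define i where "i = - d * e"
  have ci: "[c * i = - d] (mod int p)"
    using cong_mult[OF cong_refl[of "-d"] e] by (simp add: i_def mult_ac)
  have i2: "[i\<^sup>2 = -1] (mod int p)"
  proof -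
    have "[(c * i)\<^sup>2 = (- d)\<^sup>2] (mod int p)" by (rule cong_pow[OF ci])
    moreover have "[(- d)\<^sup>2 = c\<^sup>2 * (-1)] (mod int p)"
      unfolding assms(3) by (simp add: cong_iff_dvd_diff add.commute)
    ultimately have "[c\<^sup>2 * i\<^sup>2 = c\<^sup>2 * (-1)] (mod int p)"
      unfolding power_mult_distrib by (rule cong_trans)
    then show ?thesis using cop_cp by (subst (asm) cong_mult_lcancel) auto
  qed
  define L1 where "L1 = Legendre (1 - 4 * a) (int p)"
  define L2 where "L2 = Legendre (1 + 4 * a) (int p)"
  define L3 where "L3 = Legendre (1 + 4 * a * i) (int p)"
  define L4 where "L4 = Legendre (1 - 4 * a * i) (int p)"
  define J where "J = Jacobi (c - 4 * a * d) (16 * a ^ 2 + 1)"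
  \<comment> \<open>The symbols that separate the cases factor as \<open>L1 * L2\<close> and
    \<open>L3 * L4\<close>, so each decides whether the two members of its pair are equal or
    opposite.\<close>
  have L12: "Legendre (1 - 16 * a ^ 2) (int p) = L1 * L2"
    unfolding L1_def L2_def Legendre_mult[OF P p2, symmetric]
    by (simp add: algebra_simps power2_eq_square)
  have L34: "Legendre (1 + 16 * a ^ 2) (int p) = L3 * L4"
    unfolding L3_def L4_def Legendre_mult[OF P p2, symmetric]
  proof (rule Legendre_cong)
    have "(1 + 4 * a * i) * (1 - 4 * a * i) = 1 - 16 * a\<^sup>2 * i\<^sup>2"
      by (simp add: algebra_simps power2_eq_square)
    moreover have "[1 - 16 * a\<^sup>2 * i\<^sup>2 = 1 - 16 * a\<^sup>2 * (-1)] (mod int p)"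
      by (intro cong_diff cong_mult cong_refl i2)
    ultimately show "[1 + 16 * a\<^sup>2 = (1 + 4 * a * i) * (1 - 4 * a * i)] (mod int p)"
      by (simp add: cong_sym)
  qed
  have L3: "L3 = J"
  proof -
    have "[c + 4 * a * (c * i) = c + 4 * a * (- d)] (mod int p)"
      by (intro cong_add cong_mult cong_refl ci)
    then have "[c * (1 + 4 * a * i) = c - 4 * a * d] (mod int p)"
      by (simp add: algebra_simps)
    \<comment> \<open>The factor \<open>c\<close> clears the denominator of \<open>i\<close> at no
      cost, because its symbol is 1.\<close>
    then have "Legendre c (int p) * L3 = Legendre (c - 4 * a * d) (int p)"
      unfolding L3_def Legendre_mult[OF P p2, symmetric] by (rule Legendre_cong)
    moreover have "Legendre c (int p) = 1"
      by (rule Legendre_sum_two_squares_eq_1[OF P p4 assms(3) odd_c cop])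
    moreover have "Legendre (c - 4 * a * d) (int p) = J"
      using Legendre_eq_Jacobi_two_squares[OF P p4 assms(3) odd_c _ cop, of "4 * a"]
      by (simp add: J_def power_mult_distrib)
    ultimately show ?thesis by simp
  qed
  have S: "[S = 2 * (\<Sum>k\<le>n div 4. int (n choose (4 * k)) * (4 * a) ^ (4 * k))] (mod int p)"
  proof -
    \<comment> \<open>The upper limits coincide since p = 2n + 1.\<close>
    have range: "{0..p div 8} = {..n div 4}"
      using n(1) by (auto simp: atMost_atLeast0)
    show ?thesis unfolding S_def range
    proof (rule cong_mult[OF cong_refl cong_sum])
      fix k assume "k \<in> {..n div 4}"
      then have "4 * k \<le> n" by auto
      \<comment> \<open>The lemma is used at index 4k; the exponent is even, so the sign of -4
        disappears and its power merges with that of \<open>a\<close>.\<close>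
      from cong_mult[OF central_binomial_cong[OF assms(1) n(1) this] cong_refl[of "a ^ (4 * k)"]]
      show "[int ((8 * k) choose (4 * k)) * a ^ (4 * k)
          = int (n choose (4 * k)) * (4 * a) ^ (4 * k)] (mod int p)"
        by (simp add: power_mult_distrib mult_ac)
    qed
  qed
  have euler: "[Legendre x (int p) = x ^ n] (mod int p)" for x
    using euler_criterion_int[OF P p2, of x] np by simp
  define T where "T = (\<Sum>k\<le>n div 4. int (n choose (4 * k)) * (4 * a) ^ (4 * k))"
  have "[L2 + L1 + L3 + L4 = (1 + 4 * a) ^ n + (1 - 4 * a) ^ n + (1 + 4 * a * i) ^ n
      + (1 - 4 * a * i) ^ n] (mod int p)"
    unfolding L1_def L2_def L3_def L4_def by (intro cong_add euler)
  from cong_trans[OF this binomial_quadrisection_cong[OF i2]]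
  have "[L1 + L2 + L3 + L4 = 4 * T] (mod int p)" by (simp add: T_def add.commute)
  moreover have "[2 * S = 4 * T] (mod int p)"
    using cong_mult[OF cong_refl[of 2] S] by (simp add: T_def)
  ultimately have main: "[2 * S = L1 + L2 + L3 + L4] (mod int p)"
    using cong_sym cong_trans by blast
  have "coprime 2 (int p)" using n by simp
  then have half: "[S = X] (mod int p)" if "L1 + L2 + L3 + L4 = 2 * X" for X
    using main unfolding that by (simp only: cong_mult_lcancel)
  have signs: "L1 \<in> {0, 1, -1}" "L2 \<in> {0, 1, -1}" "L3 \<in> {0, 1, -1}" "L4 \<in> {0, 1, -1}"
    unfolding L1_def L2_def L3_def L4_def using Legendre_cases by blast+
  show ?thesis
    unfolding L12 L34 L1_def[symmetric] J_def[symmetric] L3[symmetric]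
    \<comment> \<open>A pair with product 1 has equal members and contributes 2 \<open>L1\<close> or
      2 \<open>L3\<close>; a pair with product -1 cancels. The value 0 is excluded by the case
      hypotheses.\<close>
    by (intro conjI impI half) (use signs in auto)
qed

end
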